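(* Let $A_1,A_2,A_3,A_4$ be the vertices of a quadrilateral with sides (lines) $a_{i(i+1)}=A_i\times A_{i+1}$ for $i\in\{1,2,3,4\}$ (indices taken cyclically modulo 4), and let $A_5=a_{12}\times a_{34}$, $A_6=a_{41}\times a_{23}$. Assume that through each vertex $A_i$, $i\in\{1,2,3,4\}$, two lines $g_i,h_i$ are given which together with the sides form a harmonic pencil $(a_{(i-1)i}a_{i(i+1)};g_ih_i)$. Consider the following four pairs of lines $\ell^{(i)}=(\ell^{(i)}_1,\ell^{(i)}_2)$, where each line is the line through the three listed (automatically collinear) points: $$\begin{array}{ll} \ell^{(1)}_1:\ A_5,\ g_1\times h_4,\ h_1\times g_4; & \ell^{(1)}_2:\ A_5,\ g_3\times h_2,\ h_3\times g_2;\\ \ell^{(2)}_1:\ A_5,\ g_1\times g_4,\ h_1\times h_4; & \ell^{(2)}_2:\ A_5,\ g_2\times g_3,\ h_2\times h_3;\\ \ell^{(3)}_1:\ A_6,\ g_1\times h_2,\ h_1\times g_2; & \ell^{(3)}_2:\ A_6,\ g_3\times h_4,\ h_3\times g_4;\\ \ell^{(4)}_1:\ A_6,\ g_1\times g_2,\ h_1\times h_2; & \ell^{(4)}_2:\ A_6,\ g_3\times g_4,\ h_3\times h_4. \end{array}$$ Then, if the two lines of one of the pairs $\ell^{(i)}$ coincide, the two lines of each of the four pairs coincide, and this is the case if and only if one of the following two equivalent conditions holds: (i) $$\prod_{i=1}^4\frac{A_iB_{i(i+1)(i+2)}}{B_{i(i+1)(i+2)}A_{i+1}}\cdot\frac{A_iB_{i(i+1)(i+3)}}{B_{i(i+1)(i+3)}A_{i+1}}=1,$$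 where $B_{ijk}=a_{ij}\times g_k$ (indices modulo 4); (ii) $$\frac{A_1D_2}{D_2A_3}\cdot\frac{A_2D_3}{D_3A_4}\cdot\frac{A_3D_4}{D_4A_1}\cdot\frac{A_4D_1}{D_1A_2}=1,$$ where $D_1=g_1\times(A_2\times A_4)$, $D_3=g_3\times(A_2\times A_4)$, $D_2=g_2\times(A_1\times A_3)$, $D_4=g_4\times(A_1\times A_3)$.
   Context: The setting is the real projective plane, with $A_1,\dots,A_4$ in the affine (Euclidean) part, no three of them collinear. $A\times B$ is the line through distinct points $A,B$; $g\times h$ is the intersection point of distinct lines $g,h$. A harmonic pencil $(gh;uv)$ consists of four distinct concurrent lines such that $v$ is the harmonic conjugate of $u$ with respect to $g$ and $h$ (cross-ratio $-1$ in the classical normalization). For collinear points, $\frac{AB}{CD}$ is the quotient of oriented lengths of segments on an oriented line; as usual $\frac{AX}{XB}=-1$ if $X$ is the point at infinity of the line $AB$. In condition (i) it is understood that all fractions are well defined and nonzero, i.e. no point $B_{ijk}$ occurring there coincides with one of the vertices $A_1,\dots,A_4$ (no $g_i$ is a diagonal of the quadrilateral). *)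

theory Defs
  imports "HOL-Analysis.Analysis"
begin

text \<open>
  The real projective plane is the projective space of \<open>real^3\<close>: points are the 1-dimensional
  and lines the 2-dimensional subspaces, and a point \<open>P\<close> lies on a line \<open>l\<close> iff \<open>P \<subseteq> l\<close>.
\<close>

definition proj_point :: "(real^3) set \<Rightarrow> bool" where
  "proj_point P \<longleftrightarrow> subspace P \<and> dim P = 1"

definition proj_line :: "(real^3) set \<Rightarrow> bool" where
  "proj_line l \<longleftrightarrow> subspace l \<and> dim l = 2"

text \<open>\<open>P \<times> Q\<close> for distinct points and \<open>g \<times> h\<close> for distinct lines.\<close>

definition join :: "(real^3) set \<Rightarrow> (real^3) set \<Rightarrow> (real^3) set" where
  "join P Q = span (P \<union> Q)"

definition meet :: "(real^3) set \<Rightarrow> (real^3) set \<Rightarrow> (real^3) set" where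
  "meet g h = g \<inter> h"

definition line_through :: "(real^3) set set \<Rightarrow> (real^3) set" where
  "line_through S = (THE l. proj_line l \<and> (\<forall>P\<in>S. P \<subseteq> l))"

text \<open>
  The Euclidean plane \<open>real^2\<close> sits in the projective plane as the points off the line
  \<open>x\<^sub>3 = 0\<close>.
\<close>

definition pt :: "real^2 \<Rightarrow> (real^3) set" where
  "pt x = span {vector [x$1, x$2, 1]}"

definition at_infty :: "(real^3) set \<Rightarrow> bool" where
  "at_infty P \<longleftrightarrow> (\<forall>v\<in>P. v$3 = 0)"

definition line_of :: "real^3 \<Rightarrow> (real^3) set" where
  "line_of m = {x. m \<bullet> x = 0}"

text \<open>
  Cross-ratio of four distinct concurrent lines: if \<open>g\<close>, \<open>h\<close>, \<open>v\<close> have the equations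
  \<open>m = 0\<close>, \<open>n = 0\<close>, \<open>m + n = 0\<close>, then \<open>u\<close> has the equation \<open>m + k n = 0\<close>, where \<open>k\<close> is
  the cross-ratio (the coordinate of \<open>u\<close> in which \<open>g\<close>, \<open>h\<close>, \<open>v\<close> are 0, \<open>\<infinity>\<close>, 1).
\<close>

definition cross_ratio ::
    "(real^3) set \<Rightarrow> (real^3) set \<Rightarrow> (real^3) set \<Rightarrow> (real^3) set \<Rightarrow> real" where
  "cross_ratio g h u v = (THE k. \<exists>m n. g = line_of m \<and> h = line_of n \<and>
     v = line_of (m + n) \<and> u = line_of (m + k *\<^sub>R n))"

definition harmonic_pencil ::
    "(real^3) set \<Rightarrow> (real^3) set \<Rightarrow> (real^3) set \<Rightarrow> (real^3) set \<Rightarrow> bool" where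
  "harmonic_pencil g h u v \<longleftrightarrow>
     proj_line g \<and> proj_line h \<and> proj_line u \<and> proj_line v \<and> distinct [g, h, u, v] \<and>
     (\<exists>P. proj_point P \<and> P \<subseteq> g \<and> P \<subseteq> h \<and> P \<subseteq> u \<and> P \<subseteq> v) \<and>
     cross_ratio g h u v = -1"

text \<open>
  \<open>seg_ratio A X B\<close> is the quotient \<open>AX / XB\<close> of oriented lengths, for a point \<open>X \<noteq> B\<close> of the
  line \<open>AB\<close>. Lengths are oriented by the unit vector from \<open>A\<close> to \<open>B\<close>; the opposite orientation
  gives the same quotient.
\<close>

definition oriented_length :: "real^2 \<Rightarrow> real^2 \<Rightarrow> real^2 \<Rightarrow> real" where
  "oriented_length e P Q = (Q - P) \<bullet> e"

definition seg_ratio :: "real^2 \<Rightarrow> (real^3) set \<Rightarrow> real^2 \<Rightarrow> real" where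
  "seg_ratio A X B =
     (if at_infty X then -1
      else let x = (THE x. X = pt x); e = sgn (B - A)
           in oriented_length e A x / oriented_length e x B)"

text \<open>
  Vertices and lines of the configuration are indexed by the type \<open>4\<close> of integers modulo 4, so
  index arithmetic is cyclic and \<open>4 = 0\<close>. The intersection points \<open>A\<^sub>5\<close> and \<open>A\<^sub>6\<close> of opposite
  sides are therefore separate constants.
\<close>

definition vline :: "(4 \<Rightarrow> real^2) \<Rightarrow> 4 \<Rightarrow> 4 \<Rightarrow> (real^3) set" where
  "vline A i j = join (pt (A i)) (pt (A j))"

definition A5 :: "(4 \<Rightarrow> real^2) \<Rightarrow> (real^3) set" where
  "A5 A = meet (vline A 1 2) (vline A 3 4)"

definition A6 :: "(4 \<Rightarrow> real^2) \<Rightarrow> (real^3) set" where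
  "A6 A = meet (vline A 4 1) (vline A 2 3)"

definition ell_points :: "(4 \<Rightarrow> real^2) \<Rightarrow> (4 \<Rightarrow> (real^3) set) \<Rightarrow> (4 \<Rightarrow> (real^3) set) \<Rightarrow> 4
    \<Rightarrow> (real^3) set set \<times> (real^3) set set" where
  "ell_points A g h i =
    (if i = 1 then
       ({A5 A, meet (g 1) (h 4), meet (h 1) (g 4)}, {A5 A, meet (g 3) (h 2), meet (h 3) (g 2)})
     else if i = 2 then
       ({A5 A, meet (g 1) (g 4), meet (h 1) (h 4)}, {A5 A, meet (g 2) (g 3), meet (h 2) (h 3)})
     else if i = 3 then
       ({A6 A, meet (g 1) (h 2), meet (h 1) (g 2)}, {A6 A, meet (g 3) (h 4), meet (h 3) (g 4)})
     else
       ({A6 A, meet (g 1) (g 2), meet (h 1) (h 2)}, {A6 A, meet (g 3) (g 4), meet (h 3) (h 4)}))"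

definition ell1 :: "(4 \<Rightarrow> real^2) \<Rightarrow> (4 \<Rightarrow> (real^3) set) \<Rightarrow> (4 \<Rightarrow> (real^3) set) \<Rightarrow> 4
    \<Rightarrow> (real^3) set" where
  "ell1 A g h i = line_through (fst (ell_points A g h i))"

definition ell2 :: "(4 \<Rightarrow> real^2) \<Rightarrow> (4 \<Rightarrow> (real^3) set) \<Rightarrow> (4 \<Rightarrow> (real^3) set) \<Rightarrow> 4
    \<Rightarrow> (real^3) set" where
  "ell2 A g h i = line_through (snd (ell_points A g h i))"

definition B_pt :: "(4 \<Rightarrow> real^2) \<Rightarrow> (4 \<Rightarrow> (real^3) set) \<Rightarrow> 4 \<Rightarrow> 4 \<Rightarrow> 4 \<Rightarrow> (real^3) set" where
  "B_pt A g i j k = meet (vline A i j) (g k)"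

text \<open>The diagonal not through \<open>A\<^sub>k\<close>: \<open>A\<^sub>2A\<^sub>4\<close> for \<open>k = 1, 3\<close>, and for \<open>k = 2, 4\<close> the diagonal \<open>A\<^sub>1A\<^sub>3\<close>.\<close>

definition D_pt :: "(4 \<Rightarrow> real^2) \<Rightarrow> (4 \<Rightarrow> (real^3) set) \<Rightarrow> 4 \<Rightarrow> (real^3) set" where
  "D_pt A g k = meet (g k) (if k = 1 \<or> k = 3 then vline A 2 4 else vline A 1 3)"

text \<open>All quotients in \<open>cond_i\<close> are defined and nonzero.\<close>

definition cond_i_defined :: "(4 \<Rightarrow> real^2) \<Rightarrow> (4 \<Rightarrow> (real^3) set) \<Rightarrow> bool" where
  "cond_i_defined A g \<longleftrightarrow>
     (\<forall>i m. B_pt A g i (i+1) (i+2) \<noteq> pt (A m) \<and> B_pt A g i (i+1) (i+3) \<noteq> pt (A m))"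

definition cond_i :: "(4 \<Rightarrow> real^2) \<Rightarrow> (4 \<Rightarrow> (real^3) set) \<Rightarrow> bool" where
  "cond_i A g \<longleftrightarrow>
     (\<Prod>i\<in>UNIV. seg_ratio (A i) (B_pt A g i (i+1) (i+2)) (A (i+1)) *
                seg_ratio (A i) (B_pt A g i (i+1) (i+3)) (A (i+1))) = 1"

definition cond_ii :: "(4 \<Rightarrow> real^2) \<Rightarrow> (4 \<Rightarrow> (real^3) set) \<Rightarrow> bool" where
  "cond_ii A g \<longleftrightarrow>
     seg_ratio (A 1) (D_pt A g 2) (A 3) * seg_ratio (A 2) (D_pt A g 3) (A 4) *
     seg_ratio (A 3) (D_pt A g 4) (A 1) * seg_ratio (A 4) (D_pt A g 1) (A 2) = 1"

end

theory Submission
  imports Defs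
begin

text \<open>
  Let \<open>s\<^sub>i\<close> be the linear form \<open>A\<^sub>i \<times> A\<^sub>i\<^sub>+\<^sub>1\<close> of a side, in homogeneous coordinates. Harmonicity means
  that \<open>g\<^sub>i\<close> and \<open>h\<^sub>i\<close> have the equations \<open>s\<^sub>i\<^sub>-\<^sub>1 \<plusminus> t\<^sub>i s\<^sub>i = 0\<close> with \<open>t\<^sub>i \<noteq> 0\<close>. Eliminating \<open>s\<^sub>i\<close> from the
  equations of \<open>g\<^sub>i\<close>, \<open>h\<^sub>i\<close>, \<open>g\<^sub>i\<^sub>+\<^sub>1\<close>, \<open>h\<^sub>i\<^sub>+\<^sub>1\<close> shows that the lines in question are
  \<open>s\<^sub>i\<^sub>-\<^sub>1 \<plusminus> t\<^sub>i t\<^sub>i\<^sub>+\<^sub>1 s\<^sub>i\<^sub>+\<^sub>1 = 0\<close>, so the two lines of any pair coincide iff \<open>t\<^sub>1 t\<^sub>2 t\<^sub>3 t\<^sub>4 = 1\<close>. A line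
  with form \<open>w\<close> cuts \<open>AB\<close> in the ratio \<open>- w(A) / w(B)\<close>; hence the product in (ii) is
  \<open>t\<^sub>1 t\<^sub>2 t\<^sub>3 t\<^sub>4\<close>, and the product in (i) telescopes to its inverse.
\<close>

subsection \<open>Lines and their equations\<close>

text \<open>Cramer's rule for four vectors, with denominators cleared: a polynomial identity in the
  coordinates.\<close>

lemma det_expansion:
  fixes x y z w :: "real^3"
  shows "(x \<bullet> cross3 y z) *\<^sub>R w =
    (w \<bullet> cross3 y z) *\<^sub>R x + (x \<bullet> cross3 w z) *\<^sub>R y + (x \<bullet> cross3 y w) *\<^sub>R z"
  unfolding vec_eq_iff forall_3
  by (simp add: cross3_def inner_vec_def sum_3; intro conjI; algebra)

text \<open>Pairing the relation with the cross product of two of the vectors isolates the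
  coefficient of the third.\<close>

lemma independent3:
  fixes x y z :: "real^3"
  assumes "x \<bullet> cross3 y z \<noteq> 0" and "a *\<^sub>R x + b *\<^sub>R y + c *\<^sub>R z = 0"
  shows "a = 0" "b = 0" "c = 0"
proof -
  have "a * (x \<bullet> cross3 y z) = (a *\<^sub>R x + b *\<^sub>R y + c *\<^sub>R z) \<bullet> cross3 y z"
    and "b * (x \<bullet> cross3 y z) = (a *\<^sub>R x + b *\<^sub>R y + c *\<^sub>R z) \<bullet> cross3 z x"
    and "c * (x \<bullet> cross3 y z) = (a *\<^sub>R x + b *\<^sub>R y + c *\<^sub>R z) \<bullet> cross3 x y"
    by (simp_all add: cross3_simps)
  then show "a = 0" "b = 0" "c = 0"
    using assms(1) unfolding assms(2) by simp_all
qed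

lemma independent2:
  fixes m n :: "real^3"
  assumes "cross3 m n \<noteq> 0" and "a *\<^sub>R m + b *\<^sub>R n = 0"
  shows "a = 0" "b = 0"
proof -
  have "a *\<^sub>R cross3 m n = cross3 (a *\<^sub>R m + b *\<^sub>R n) n"
    and "b *\<^sub>R cross3 m n = cross3 m (a *\<^sub>R m + b *\<^sub>R n)"
    by (simp_all add: cross_add_left cross_add_right cross_mult_left cross_mult_right)
  then show "a = 0" "b = 0"
    using assms unfolding assms(2) by simp_all
qed

lemma eq_combination2:
  fixes m n :: "real^3"
  assumes "cross3 m n \<noteq> 0" and "a *\<^sub>R m + b *\<^sub>R n = c *\<^sub>R m + d *\<^sub>R n"
  shows "a = c \<and> b = d"
proof -
  have "(a - c) *\<^sub>R m + (b - d) *\<^sub>R n = 0"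
    using assms(2) by (simp add: algebra_simps)
  then show ?thesis
    using independent2[OF assms(1)] by fastforce
qed

text \<open>The component of \<open>w'\<close> orthogonal to \<open>w\<close> lies in
  \<open>line_of w\<close>, hence in \<open>line_of w'\<close>, so it is orthogonal to
  itself.\<close>

lemma line_of_subset_imp:
  assumes "line_of w \<subseteq> line_of w'"
  shows "\<exists>k. w' = k *\<^sub>R w"
proof (cases "w = 0")
  case True
  then have "w' = 0"
    using subsetD[OF assms, of w'] by (simp add: line_of_def)
  then show ?thesis
    by simp
next
  case False
  define k where "k = (w' \<bullet> w) / (w \<bullet> w)"
  have 1: "w \<bullet> (w' - k *\<^sub>R w) = 0"
    using False by (simp add: k_def inner_diff_right inner_commute)
  then have "w' \<bullet> (w' - k *\<^sub>R w) = 0"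
    using assms by (auto simp: line_of_def)
  with 1 have "(w' - k *\<^sub>R w) \<bullet> (w' - k *\<^sub>R w) = 0"
    by (simp add: inner_diff_left)
  then show ?thesis
    by auto
qed

lemma line_of_scale: "k \<noteq> 0 \<Longrightarrow> line_of (k *\<^sub>R w) = line_of w"
  by (simp add: line_of_def)

lemma line_of_eq_imp:
  assumes "line_of w' = line_of w" and "w \<noteq> 0"
  obtains k where "k \<noteq> 0" "w' = k *\<^sub>R w"
proof -
  obtain k where "w' = k *\<^sub>R w"
    using line_of_subset_imp assms(1) by blast
  moreover have "w' \<noteq> 0"
    using assms line_of_subset_imp[of w' w] by auto
  ultimately show ?thesis
    using that by auto
qed

lemma proj_line_iff: "proj_line l \<longleftrightarrow> (\<exists>w. w \<noteq> 0 \<and> l = line_of w)"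
proof
  assume l: "proj_line l"
  then obtain w where w: "w \<noteq> 0" "l \<subseteq> line_of w"
    using lowdim_subset_hyperplane[of l] span_superset[of l]
    by (auto simp: proj_line_def line_of_def)
  have "l = line_of w"
    using l w subspace_dim_equal[of l "line_of w"]
    by (simp add: proj_line_def line_of_def subspace_hyperplane dim_hyperplane)
  with w show "\<exists>w. w \<noteq> 0 \<and> l = line_of w"
    by blast
next
  assume "\<exists>w. w \<noteq> 0 \<and> l = line_of w"
  then show "proj_line l"
    by (auto simp: proj_line_def line_of_def subspace_hyperplane dim_hyperplane)
qed

lemma proj_line_line_of: "proj_line (line_of w) \<longleftrightarrow> w \<noteq> 0"
proof
  assume "proj_line (line_of w)"
  then obtain w' where "w' \<noteq> 0" "line_of w = line_of w'"
    by (auto simp: proj_line_iff)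
  then show "w \<noteq> 0"
    using line_of_subset_imp[of w w'] by auto
qed (auto simp: proj_line_iff)

text \<open>Cramer's rule for the basis \<open>m\<close>, \<open>n\<close>,
  \<open>cross3 m n\<close>: the third coefficient vanishes by the assumption on
  \<open>w\<close>.\<close>

lemma mem_line_of_cross3_imp:
  assumes "cross3 m n \<noteq> 0" and "w \<in> line_of (cross3 m n)"
  obtains a b where "w = a *\<^sub>R m + b *\<^sub>R n"
proof -
  define v where "v = cross3 m n"
  define d where "d = m \<bullet> cross3 n v"
  have wv: "m \<bullet> cross3 n w = 0"
    using assms(2) by (simp add: line_of_def cross3_simps)
  have d: "d \<noteq> 0"
  proof -
    have "d = v \<bullet> v"
      unfolding d_def v_def by (simp add: cross3_simps)
    then show ?thesis
      using assms(1) by (simp add: v_def)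
  qed
  have "d *\<^sub>R w = (w \<bullet> cross3 n v) *\<^sub>R m + (m \<bullet> cross3 w v) *\<^sub>R n"
    using det_expansion[of m n v w] wv by (simp add: d_def)
  then have "w = inverse d *\<^sub>R ((w \<bullet> cross3 n v) *\<^sub>R m + (m \<bullet> cross3 w v) *\<^sub>R n)"
    using d by (metis left_inverse scaleR_one scaleR_scaleR)
  then have "w = ((w \<bullet> cross3 n v) / d) *\<^sub>R m + ((m \<bullet> cross3 w v) / d) *\<^sub>R n"
    by (simp add: scaleR_add_right divide_inverse mult.commute)
  then show ?thesis
    using that by blast
qed

text \<open>A line through the intersection of two lines belongs to their pencil;
  \<open>cross3 m n\<close> represents that intersection.\<close>

lemma line_of_Int_subset_imp:
  assumes "cross3 m n \<noteq> 0" and "line_of m \<inter> line_of n \<subseteq> line_of w"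
  obtains a b where "w = a *\<^sub>R m + b *\<^sub>R n"
proof -
  have "cross3 m n \<in> line_of w"
    using assms(2) by (rule subsetD) (simp add: line_of_def dot_cross_self)
  then show ?thesis
    using mem_line_of_cross3_imp[OF assms(1)] that by (metis inner_commute line_of_def mem_Collect_eq)
qed

lemma line_of_Int:
  assumes "cross3 m n \<noteq> 0"
  shows "line_of m \<inter> line_of n = span {cross3 m n}"
proof
  show "line_of m \<inter> line_of n \<subseteq> span {cross3 m n}"
  proof
    fix x assume x: "x \<in> line_of m \<inter> line_of n"
    define v where "v = cross3 m n"
    \<comment> \<open>Expansion of \<open>x\<close> in the dual basis of \<open>m\<close>,
      \<open>n\<close>, \<open>v\<close>, scaled by their determinant
      \<open>v \<bullet> v\<close>.\<close>
    have *: "(v \<bullet> v) *\<^sub>R x = (v \<bullet> x) *\<^sub>R v + (n \<bullet> x) *\<^sub>R cross3 v m - (m \<bullet> x) *\<^sub>R cross3 v n"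
      unfolding v_def by (simp add: cross3_simps forall_3)
    have "(v \<bullet> v) *\<^sub>R x = (v \<bullet> x) *\<^sub>R v"
      using x * by (simp add: line_of_def)
    then have "x = ((v \<bullet> x) / (v \<bullet> v)) *\<^sub>R v"
      using assms unfolding v_def
      by (simp add: eq_vector_fraction_iff)
    then show "x \<in> span {cross3 m n}"
      unfolding v_def by (metis span_base span_scale singletonI)
  qed
  have "cross3 m n \<in> line_of m \<inter> line_of n"
    by (simp add: line_of_def dot_cross_self)
  then show "span {cross3 m n} \<subseteq> line_of m \<inter> line_of n"
    by (intro span_minimal subspace_Int)
      (auto simp: line_of_def subspace_hyperplane intro!: subspace_inter)
qed

lemma cross3_nonzero_if_distinct_lines:
  assumes "m \<noteq> 0" "n \<noteq> 0" "line_of m \<noteq> line_of n"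
  shows "cross3 m n \<noteq> 0"
proof
  assume "cross3 m n = 0"
  then have "collinear {0, m, n}"
    by (simp add: cross_eq_0)
  then obtain c where "n = c *\<^sub>R m"
    using assms by (auto simp: collinear_lemma)
  then show False
    using assms line_of_scale by fastforce
qed

subsection \<open>Harmonic pencils\<close>

lemma combination_line_of_in_pencil:
  assumes "proj_line l" "proj_point P" "P \<subseteq> line_of m" "P \<subseteq> line_of n" "P \<subseteq> l"
    and mn: "cross3 m n \<noteq> 0"
  obtains a b where "l = line_of (a *\<^sub>R m + b *\<^sub>R n)"
proof -
  obtain w where w: "w \<noteq> 0" "l = line_of w"
    using assms(1) by (auto simp: proj_line_iff)
  have "dim (line_of m \<inter> line_of n) \<le> dim P"
    using assms(2) mn by (simp add: line_of_Int proj_point_def)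
  then have "P = line_of m \<inter> line_of n"
    using assms(2-4) by (intro subspace_dim_equal subspace_inter)
      (simp_all add: proj_point_def line_of_def subspace_hyperplane)
  then obtain a b where "w = a *\<^sub>R m + b *\<^sub>R n"
    using line_of_Int_subset_imp[OF mn] assms(5) w by metis
  then show ?thesis
    using w that by blast
qed

text \<open>Makes the definite description in \<open>cross_ratio\<close> usable. Existence: rescale
  the equations of \<open>g\<close> and \<open>h\<close> so that \<open>v\<close> becomes their sum.
  Uniqueness: \<open>v\<close> forces both equations to be rescaled by the same factor, and then
  \<open>u\<close> fixes \<open>k\<close>.\<close>

lemma cross_ratio_ex1:
  assumes "harmonic_pencil g h u v"
  shows "\<exists>!k. \<exists>m n. g = line_of m \<and> h = line_of n \<and>
           v = line_of (m + n) \<and> u = line_of (m + k *\<^sub>R n)"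
proof -
  from assms obtain P where pl: "proj_line g" "proj_line h" "proj_line u" "proj_line v"
    and dist: "distinct [g, h, u, v]"
    and P: "proj_point P" "P \<subseteq> g" "P \<subseteq> h" "P \<subseteq> u" "P \<subseteq> v"
    by (auto simp: harmonic_pencil_def)
  obtain m0 n0 where m0: "m0 \<noteq> 0" "g = line_of m0" and n0: "n0 \<noteq> 0" "h = line_of n0"
    using pl by (auto simp: proj_line_iff)
  have mn0: "cross3 m0 n0 \<noteq> 0"
    using dist m0 n0 by (intro cross3_nonzero_if_distinct_lines) auto
  obtain a b where v: "v = line_of (a *\<^sub>R m0 + b *\<^sub>R n0)"
    using combination_line_of_in_pencil[OF pl(4) P(1)] P m0 n0 mn0 by metis
  obtain c d where u: "u = line_of (c *\<^sub>R m0 + d *\<^sub>R n0)"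
    using combination_line_of_in_pencil[OF pl(3) P(1)] P m0 n0 mn0 by metis
  \<comment> \<open>A zero coefficient would make \<open>v\<close> equal to \<open>h\<close> or
    \<open>g\<close>, or \<open>u\<close> equal to \<open>h\<close>.\<close>
  have "a \<noteq> 0" "b \<noteq> 0" "c \<noteq> 0"
    using dist pl v u m0 n0 line_of_scale by (fastforce simp: proj_line_line_of)+
  define m n k where "m = a *\<^sub>R m0" "n = b *\<^sub>R n0" "k = a * d / (b * c)"
  have g: "g = line_of m" and h: "h = line_of n"
    using m0 n0 \<open>a \<noteq> 0\<close> \<open>b \<noteq> 0\<close> by (simp_all add: m_n_k_def line_of_scale)
  have vk: "v = line_of (m + n)"
    using v by (simp add: m_n_k_def)
  have "m + k *\<^sub>R n = (a / c) *\<^sub>R (c *\<^sub>R m0 + d *\<^sub>R n0)"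
    using \<open>b \<noteq> 0\<close> \<open>c \<noteq> 0\<close> by (simp add: m_n_k_def algebra_simps)
  then have uk: "u = line_of (m + k *\<^sub>R n)"
    using u \<open>a \<noteq> 0\<close> \<open>c \<noteq> 0\<close> by (simp add: line_of_scale)
  have mn: "cross3 m n \<noteq> 0" "m \<noteq> 0" "n \<noteq> 0"
    using mn0 m0 n0 \<open>a \<noteq> 0\<close> \<open>b \<noteq> 0\<close>
    by (simp_all add: m_n_k_def cross_mult_left cross_mult_right)
  have "k' = k"
    if k': "g = line_of m'" "h = line_of n'" "v = line_of (m' + n')" "u = line_of (m' + k' *\<^sub>R n')"
    for k' m' n'
  proof -
    obtain p where p: "m' = p *\<^sub>R m"
      using g k' mn line_of_eq_imp by metis
    obtain q where q: "n' = q *\<^sub>R n"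
      using h k' mn line_of_eq_imp by metis
    have "m + n \<noteq> 0" "m + k *\<^sub>R n \<noteq> 0"
      using vk uk pl by (auto simp: proj_line_line_of)
    then obtain r s where rs: "r \<noteq> 0" "m' + n' = r *\<^sub>R (m + n)" "s \<noteq> 0"
        "m' + k' *\<^sub>R n' = s *\<^sub>R (m + k *\<^sub>R n)"
      using line_of_eq_imp vk uk k' by metis
    then have "p = r \<and> q = r" "p = s \<and> k' * q = s * k"
      using p q by (auto intro!: eq_combination2[OF mn(1)] simp: algebra_simps)
    then show ?thesis
      using rs by auto
  qed
  then show ?thesis
    using g h vk uk by blast
qed

text \<open>Keeps the equations \<open>m\<close>, \<open>n\<close> of the sides as given, so that
  equations at different vertices share them; the rescaling in \<open>cross_ratio\<close> is
  absorbed into \<open>t\<close>.\<close>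

lemma harmonic_pencil_line_of:
  assumes hp: "harmonic_pencil (line_of m) (line_of n) u v"
  obtains t where "t \<noteq> 0" "u = line_of (m + t *\<^sub>R n)" "v = line_of (m - t *\<^sub>R n)"
proof -
  have mn: "m \<noteq> 0" "n \<noteq> 0"
    using hp by (auto simp: harmonic_pencil_def proj_line_line_of)
  have "cross_ratio (line_of m) (line_of n) u v = -1"
    using hp by (simp add: harmonic_pencil_def)
  with theI'[OF cross_ratio_ex1[OF hp], folded cross_ratio_def]
  obtain m' n' where *: "line_of m' = line_of m" "line_of n' = line_of n"
     "v = line_of (m' + n')" "u = line_of (m' + (-1) *\<^sub>R n')"
    by metis
  obtain a b where ab: "a \<noteq> 0" "m' = a *\<^sub>R m" "b \<noteq> 0" "n' = b *\<^sub>R n"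
    using * mn line_of_eq_imp by metis
  have "m' + (-1) *\<^sub>R n' = a *\<^sub>R (m + (- b / a) *\<^sub>R n)" "m' + n' = a *\<^sub>R (m - (- b / a) *\<^sub>R n)"
    using ab by (simp_all add: algebra_simps)
  then have "u = line_of (m + (- b / a) *\<^sub>R n)" "v = line_of (m - (- b / a) *\<^sub>R n)"
    using * ab(1) line_of_scale by metis+
  moreover have "- b / a \<noteq> 0"
    using ab by simp
  ultimately show ?thesis
    using that by blast
qed

text \<open>Used with three consecutive sides \<open>x\<close>, \<open>y\<close>, \<open>z\<close>:
  eliminating \<open>y\<close> from either pair of lines gives the same form in \<open>x\<close> and
  \<open>z\<close>. For uniqueness the first two points suffice: they place the line in two pencils,
  and coefficients in the basis \<open>x\<close>, \<open>y\<close>, \<open>z\<close> are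
  compared.\<close>

lemma ex1_line_through_pencil_points:
  fixes x y z :: "real^3" and t u :: real
  assumes xyz: "x \<bullet> cross3 y z \<noteq> 0"
  defines "S \<equiv> {line_of x \<inter> line_of z, line_of (x + t *\<^sub>R y) \<inter> line_of (y - u *\<^sub>R z),
               line_of (x - t *\<^sub>R y) \<inter> line_of (y + u *\<^sub>R z)}"
  shows "\<exists>!l. proj_line l \<and> (\<forall>P\<in>S. P \<subseteq> l)"
    and "line_through S = line_of (x + (t * u) *\<^sub>R z)"
proof -
  let ?w = "x + (t * u) *\<^sub>R z"
  have "?w \<noteq> 0"
    using independent3(1)[OF xyz, of 1 0 "t * u"] by auto
  then have line: "proj_line (line_of ?w)"
    by (simp add: proj_line_line_of)
  have comb: "line_of m \<inter> line_of n \<subseteq> line_of (m + k *\<^sub>R n)" for m n k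
    by (auto simp: line_of_def inner_add_left)
  have "?w = (x + t *\<^sub>R y) + (- t) *\<^sub>R (y - u *\<^sub>R z)" "?w = (x - t *\<^sub>R y) + t *\<^sub>R (y + u *\<^sub>R z)"
    by (simp_all add: algebra_simps)
  then have on_line: "\<forall>P\<in>S. P \<subseteq> line_of ?w"
    unfolding S_def using comb by (metis empty_iff insert_iff)
  have unique: "l = line_of ?w" if l: "proj_line l" "\<forall>P\<in>S. P \<subseteq> l" for l
  proof -
    obtain w where w: "w \<noteq> 0" "l = line_of w"
      using l by (auto simp: proj_line_iff)
    have "x \<bullet> cross3 y z = - y \<bullet> cross3 x z"
      by (simp add: cross3_simps)
    then have "cross3 x z \<noteq> 0"
      using xyz by auto
    then obtain a b where ab: "w = a *\<^sub>R x + b *\<^sub>R z"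
      using l w line_of_Int_subset_imp unfolding S_def by (metis insertI1)
    have "z \<bullet> cross3 (x + t *\<^sub>R y) (y - u *\<^sub>R z) = x \<bullet> cross3 y z"
      by (simp add: cross3_simps)
    then have "cross3 (x + t *\<^sub>R y) (y - u *\<^sub>R z) \<noteq> 0"
      using xyz by auto
    then obtain c d where cd: "w = c *\<^sub>R (x + t *\<^sub>R y) + d *\<^sub>R (y - u *\<^sub>R z)"
      using l w line_of_Int_subset_imp unfolding S_def by (metis insertI1 insertI2)
    have "(a - c) *\<^sub>R x + (- (c * t + d)) *\<^sub>R y + (b + d * u) *\<^sub>R z = 0"
      using ab cd by (simp add: algebra_simps)
    from independent3[OF xyz this] have "c = a" "d = - (a * t)" "b = a * (t * u)"
      by auto
    then have "w = a *\<^sub>R ?w"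
      using ab by (simp add: algebra_simps)
    then show ?thesis
      using w line_of_scale by (metis scaleR_zero_left)
  qed
  have "proj_line l \<and> (\<forall>P\<in>S. P \<subseteq> l) \<longleftrightarrow> l = line_of ?w" for l
    using line on_line unique[of l] by blast
  then show "\<exists>!l. proj_line l \<and> (\<forall>P\<in>S. P \<subseteq> l)" and "line_through S = line_of ?w"
    by (simp_all add: line_through_def)
qed

text \<open>The roles of \<open>x\<close> and \<open>z\<close> are swapped on the right because
  passing to the other line of a pair interchanges the two opposite sides.\<close>

lemma line_of_pencil_eq_iff:
  assumes xz: "cross3 x z \<noteq> 0"
  shows "line_of (x + a *\<^sub>R z) = line_of (z + b *\<^sub>R x) \<longleftrightarrow> a * b = 1"
proof
  have "z + b *\<^sub>R x \<noteq> 0"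
    using independent2(2)[OF xz, of b 1] by (auto simp: add.commute)
  moreover assume "line_of (x + a *\<^sub>R z) = line_of (z + b *\<^sub>R x)"
  ultimately obtain k where "x + a *\<^sub>R z = k *\<^sub>R (z + b *\<^sub>R x)"
    using line_of_eq_imp by metis
  then have "1 = k * b \<and> a = k"
    by (intro eq_combination2[OF xz]) (simp add: algebra_simps)
  then show "a * b = 1"
    by auto
next
  assume ab: "a * b = 1"
  then have "x + a *\<^sub>R z = a *\<^sub>R (z + b *\<^sub>R x)"
    by (simp add: algebra_simps)
  then show "line_of (x + a *\<^sub>R z) = line_of (z + b *\<^sub>R x)"
    using ab line_of_scale by (metis mult_zero_left zero_neq_one)
qed

subsection \<open>Points of the affine plane\<close>

definition homog :: "real^2 \<Rightarrow> real^3" where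
  "homog x = vector [x$1, x$2, 1]"

lemma homog_components [simp]: "homog x $ 1 = x $ 1" "homog x $ 2 = x $ 2" "homog x $ 3 = 1"
  by (simp_all add: homog_def)

lemma pt_homog: "pt x = span {homog x}"
  by (simp add: pt_def homog_def)

lemma homog_in_pt: "homog x \<in> pt x"
  by (simp add: pt_homog span_base)

lemma homog_eq_scale_iff: "homog x = k *\<^sub>R homog y \<longleftrightarrow> k = 1 \<and> x = y"
  by (auto simp: vec_eq_iff forall_3 forall_2)

lemma pt_eq_iff: "pt x = pt y \<longleftrightarrow> x = y"
proof
  assume "pt x = pt y"
  then have "homog x \<in> span {homog y}"
    using homog_in_pt pt_homog by metis
  then show "x = y"
    by (auto simp: span_singleton homog_eq_scale_iff)
qed simp

lemma span_singleton_scale: "k \<noteq> 0 \<Longrightarrow> span {k *\<^sub>R v} = span {v::real^3}"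
  using span_scale[OF span_base[of "k *\<^sub>R v" "{k *\<^sub>R v}"], of "1 / k"]
  by (simp add: span_eq span_base span_scale)

lemma cross3_homog_nonzero: "a \<noteq> b \<Longrightarrow> cross3 (homog a) (homog b) \<noteq> 0"
  by (auto simp: cross3_simps forall_3 forall_2)

lemma join_pt:
  assumes "a \<noteq> b"
  shows "join (pt a) (pt b) = line_of (cross3 (homog a) (homog b))"
proof
  show "join (pt a) (pt b) \<subseteq> line_of (cross3 (homog a) (homog b))"
    unfolding join_def pt_homog line_of_def
    by (intro span_minimal Un_least subspace_hyperplane)
      (auto simp: dot_cross_self)
next
  show "line_of (cross3 (homog a) (homog b)) \<subseteq> join (pt a) (pt b)"
  proof
    fix w assume "w \<in> line_of (cross3 (homog a) (homog b))"
    then obtain k l where "w = k *\<^sub>R homog a + l *\<^sub>R homog b"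
      using mem_line_of_cross3_imp cross3_homog_nonzero[OF assms] by metis
    then show "w \<in> join (pt a) (pt b)"
      unfolding join_def by (simp add: homog_in_pt span_add span_scale span_base)
  qed
qed

text \<open>In a linear relation among the \<open>homog\<close> vectors the third coordinates make
  the coefficients sum to 1, so it is an affine relation.\<close>

lemma det_homog_nonzero:
  assumes "\<not> collinear {a, b, c}"
  shows "homog a \<bullet> cross3 (homog b) (homog c) \<noteq> 0"
proof
  assume det: "homog a \<bullet> cross3 (homog b) (homog c) = 0"
  have "b \<noteq> c"
    using assms by auto
  moreover have "homog a \<in> line_of (cross3 (homog b) (homog c))"
    using det by (simp add: line_of_def inner_commute)
  ultimately obtain k l where kl: "homog a = k *\<^sub>R homog b + l *\<^sub>R homog c"
    using mem_line_of_cross3_imp cross3_homog_nonzero by metis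
  then have "1 = k + l"
    by (metis homog_components(3) mult.right_neutral vector_add_component vector_scaleR_component real_scaleR_def)
  with kl have "a = k *\<^sub>R b + (1 - k) *\<^sub>R c"
    by (auto simp: vec_eq_iff forall_3 forall_2)
  then have "collinear {b, a, c}"
    by (auto simp: collinear_3_expand)
  then show False
    using assms by (simp add: insert_commute)
qed

lemma line_of_cross3_homog_Int:
  assumes "a \<noteq> b" and "w \<bullet> homog b \<noteq> 0"
  shows "line_of (cross3 (homog a) (homog b)) \<inter> line_of w =
    span {(w \<bullet> homog a) *\<^sub>R homog b - (w \<bullet> homog b) *\<^sub>R homog a}"
proof -
  \<comment> \<open>The expansion of the vector triple product.\<close>
  have v: "(w \<bullet> homog a) *\<^sub>R homog b - (w \<bullet> homog b) *\<^sub>R homog a = cross3 (cross3 (homog a) (homog b)) w"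
    unfolding vec_eq_iff forall_3
    by (simp add: cross3_def inner_vec_def sum_3; intro conjI; algebra)
  have "(w \<bullet> homog a) *\<^sub>R homog b - (w \<bullet> homog b) *\<^sub>R homog a \<noteq> 0"
    using independent2(1)[OF cross3_homog_nonzero[OF \<open>a \<noteq> b\<close>], of "- (w \<bullet> homog b)" "w \<bullet> homog a"] assms(2)
    by auto
  then show ?thesis
    using line_of_Int v by simp
qed

text \<open>The intersection is spanned by \<open>v\<close>, whose third coordinate
  \<open>\<alpha> - \<beta>\<close> decides whether it is at infinity. In that case the value -1 set
  in \<open>seg_ratio\<close> agrees with the formula.\<close>

lemma seg_ratio_line_of:
  assumes "a \<noteq> b" and wb: "w \<bullet> homog b \<noteq> 0"
  shows "seg_ratio a (line_of (cross3 (homog a) (homog b)) \<inter> line_of w) b = - (w \<bullet> homog a) / (w \<bullet> homog b)"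
proof -
  define \<alpha> \<beta> where "\<alpha> = w \<bullet> homog a" and "\<beta> = w \<bullet> homog b"
  define v where "v = \<alpha> *\<^sub>R homog b - \<beta> *\<^sub>R homog a"
  let ?X = "line_of (cross3 (homog a) (homog b)) \<inter> line_of w"
  have X: "?X = span {v}"
    unfolding v_def \<alpha>_def \<beta>_def using assms by (rule line_of_cross3_homog_Int)
  have v3: "v$3 = \<alpha> - \<beta>"
    by (simp add: v_def)
  show ?thesis
  proof (cases "\<alpha> = \<beta>")
    case True
    then have "at_infty ?X"
      using v3 by (auto simp: at_infty_def X span_singleton)
    then show ?thesis
      using True wb by (simp add: seg_ratio_def \<alpha>_def \<beta>_def)
  next
    case False
    define x where "x = (1 / (\<alpha> - \<beta>)) *\<^sub>R (\<alpha> *\<^sub>R b - \<beta> *\<^sub>R a)"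
    have "v = (\<alpha> - \<beta>) *\<^sub>R homog x"
      using False by (simp add: v_def x_def vec_eq_iff forall_3)
    then have Xx: "?X = pt x"
      using X False by (simp add: pt_homog span_singleton_scale)
    have inf: "\<not> at_infty (pt x)"
      using homog_in_pt[of x] unfolding at_infty_def
      by (metis homog_components(3) zero_neq_one)
    have ax: "x - a = (\<alpha> / (\<alpha> - \<beta>)) *\<^sub>R (b - a)" and xb: "b - x = (- \<beta> / (\<alpha> - \<beta>)) *\<^sub>R (b - a)"
      using False by (simp_all add: x_def vec_eq_iff field_simps)
    \<comment> \<open>The common length factor of both oriented segments, to be cancelled.\<close>
    have "(b - a) \<bullet> sgn (b - a) \<noteq> 0"
      using \<open>a \<noteq> b\<close> by (simp add: sgn_div_norm)
    then show ?thesis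
      using False wb unfolding Xx
      by (simp add: seg_ratio_def inf pt_eq_iff oriented_length_def ax xb flip: \<alpha>_def \<beta>_def)
  qed
qed

subsection \<open>The quadrilateral\<close>

text \<open>Reduces the independence of three consecutive sides to the non-collinearity of
  vertices.\<close>

lemma triple_product_consecutive_sides:
  "cross3 a b \<bullet> cross3 (cross3 b c) (cross3 c d) = (a \<bullet> cross3 b c) * (b \<bullet> cross3 c d)"
  by (simp add: cross3_def inner_vec_def sum_3; algebra)

text \<open>
  Explicit rewrite rules are needed because the simplifier does not replace a subterm \<open>5 :: 4\<close> by \<open>1\<close>.
\<close>

lemma index4:
  fixes i :: 4
  shows "i - 1 = i + 3" "i \<noteq> i + 1" "i \<noteq> i + 2" "i + 1 \<noteq> i + 2" "i + 2 + 2 = i" "i + 2 + 1 = i + 3"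
   "i + 3 + 1 = i" "i + 3 + 2 = i + 1" "i + 2 + 3 = i + 1" "i + 1 + 1 = i + 2" "i + 1 + 2 = i + 3" "i + 1 + 3 = i"
   "i + 3 + 3 = i + 2"
  by (simp_all add: algebra_simps)

lemma numerals4:
  "(1::4) + 1 = 2" "(2::4) + 1 = 3" "(3::4) + 1 = 4" "(4::4) + 1 = 1"
  "(1::4) + 2 = 3" "(2::4) + 2 = 4" "(3::4) + 2 = 1" "(4::4) + 2 = 2"
  "(1::4) + 3 = 4" "(2::4) + 3 = 1" "(3::4) + 3 = 2" "(4::4) + 3 = 3"
  by simp_all

lemma numerals4_distinct:
  "(1::4) \<noteq> 2" "(1::4) \<noteq> 3" "(1::4) \<noteq> 4" "(2::4) \<noteq> 3" "(2::4) \<noteq> 4" "(3::4) \<noteq> 4"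
  by simp_all

lemma prod_4: "prod f (UNIV :: 4 set) = f 1 * f 2 * f 3 * f 4"
  unfolding UNIV_4 by (simp add: ac_simps)

theorem theorem8:
  fixes A :: "4 \<Rightarrow> real^2" and g h :: "4 \<Rightarrow> (real^3) set"
  assumes no_three_collinear:
      "\<And>i j k. i \<noteq> j \<Longrightarrow> j \<noteq> k \<Longrightarrow> i \<noteq> k \<Longrightarrow> \<not> collinear {A i, A j, A k}"
    and through: "\<And>i. pt (A i) \<subseteq> g i \<and> pt (A i) \<subseteq> h i"
    and harmonic: "\<And>i. harmonic_pencil (vline A (i-1) i) (vline A i (i+1)) (g i) (h i)"
  shows "(\<forall>i. (\<exists>!l. proj_line l \<and> (\<forall>P\<in>fst (ell_points A g h i). P \<subseteq> l)) \<and>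
              (\<exists>!l. proj_line l \<and> (\<forall>P\<in>snd (ell_points A g h i). P \<subseteq> l)))
       \<and> ((\<exists>i. ell1 A g h i = ell2 A g h i) \<longrightarrow> (\<forall>i. ell1 A g h i = ell2 A g h i))
       \<and> ((\<forall>i. ell1 A g h i = ell2 A g h i) \<longleftrightarrow> cond_ii A g)
       \<and> (cond_i_defined A g \<longrightarrow> ((\<forall>i. ell1 A g h i = ell2 A g h i) \<longleftrightarrow> cond_i A g))"
proof -

  \<comment> \<open>Equations of the sides and of the lines through the vertices\<close>
  \<comment> \<open>Below, \<open>i + 3\<close> stands for \<open>i - 1\<close>.\<close>
  define p where "p i = homog (A i)" for i
  define s where "s i = cross3 (p i) (p (i+1))" for i
  define d where "d i = p i \<bullet> cross3 (p (i+1)) (p (i+2))" for i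
  have vline_sym: "vline A i j = vline A j i" for i j
    by (simp add: vline_def join_def Un_commute)
  have vline: "vline A i j = line_of (cross3 (p i) (p j))" if "A i \<noteq> A j" for i j
    using that by (simp add: vline_def join_pt p_def)
  have ncol: "\<not> collinear {A i, A (i+1), A (i+2)}" for i
    using index4[of i] by (intro no_three_collinear)
  have A1: "A i \<noteq> A (i+1)" and A2: "A i \<noteq> A (i+2)" for i
    using ncol[of i] by (auto simp: insert_commute)
  have d: "d i \<noteq> 0" for i
    unfolding d_def p_def using ncol by (rule det_homog_nonzero)
  have side: "vline A i (i+1) = line_of (s i)" for i
    using vline[OF A1] by (simp add: s_def)
  have side': "vline A (i+3) i = line_of (s (i+3))" for i
    using side[of "i+3"] by (simp only: index4)
  have "\<exists>t. t \<noteq> 0 \<and> g i = line_of (s (i+3) + t *\<^sub>R s i) \<and> h i = line_of (s (i+3) - t *\<^sub>R s i)" for i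
    using harmonic[of i] harmonic_pencil_line_of unfolding index4 side side' by metis
  then obtain t where t: "\<And>i. t i \<noteq> 0"
    and g: "\<And>i. g i = line_of (s (i+3) + t i *\<^sub>R s i)"
    and h: "\<And>i. h i = line_of (s (i+3) - t i *\<^sub>R s i)"
    by metis
  define w where "w i = s (i+3) + t i *\<^sub>R s i" for i

  have sss: "s (i+3) \<bullet> cross3 (s i) (s (i+1)) \<noteq> 0" for i
  proof -
    have "s (i+3) \<bullet> cross3 (s i) (s (i+1)) = d (i+3) * d i"
      unfolding s_def d_def index4 by (rule triple_product_consecutive_sides)
    then show ?thesis
      using d by simp
  qed
  have ss: "cross3 (s (i+3)) (s (i+1)) \<noteq> 0" for i
  proof -
    have "s (i+3) \<bullet> cross3 (s i) (s (i+1)) = - (s i \<bullet> cross3 (s (i+3)) (s (i+1)))"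
      by (simp add: cross3_simps)
    then show ?thesis
      using sss[of i] by auto
  qed

  \<comment> \<open>The four pairs of lines\<close>
  \<comment> \<open>Replacing \<open>t (i+1)\<close> by its negative swaps \<open>g (i+1)\<close> and \<open>h (i+1)\<close>, hence \<open>M i\<close> and \<open>N i\<close>.\<close>
  define M where "M i = {line_of (s (i+3)) \<inter> line_of (s (i+1)), g i \<inter> h (i+1), h i \<inter> g (i+1)}" for i
  define N where "N i = {line_of (s (i+3)) \<inter> line_of (s (i+1)), g i \<inter> g (i+1), h i \<inter> h (i+1)}" for i
  have M: "\<exists>!l. proj_line l \<and> (\<forall>P\<in>M i. P \<subseteq> l)"
    "line_through (M i) = line_of (s (i+3) + (t i * t (i+1)) *\<^sub>R s (i+1))" for i
    using ex1_line_through_pencil_points[OF sss, of i "t i" "t (i+1)"] unfolding M_def g h index4 by simp_all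
  have N: "\<exists>!l. proj_line l \<and> (\<forall>P\<in>N i. P \<subseteq> l)"
    "line_through (N i) = line_of (s (i+3) + (t i * - t (i+1)) *\<^sub>R s (i+1))" for i
    using ex1_line_through_pencil_points[OF sss, of i "t i" "- t (i+1)"] unfolding N_def g h index4 by simp_all
  have A5: "A5 A = line_of (s 1) \<inter> line_of (s 3)" and A6: "A6 A = line_of (s 4) \<inter> line_of (s 2)"
    using side[of 1] side[of 2] side[of 3] side[of 4] by (simp_all only: A5_def A6_def meet_def numerals4)
  \<comment> \<open>Each triple belongs to two adjacent vertices \<open>i\<close> and
    \<open>i+1\<close>; its first point is where the two sides adjacent to the side joining them
    meet.\<close>
  have ell_points: "ell_points A g h 1 = (M 4, M 2)" "ell_points A g h 2 = (N 4, N 2)"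
    "ell_points A g h 3 = (M 1, M 3)" "ell_points A g h 4 = (N 1, N 3)"
    using numerals4_distinct
    unfolding ell_points_def M_def N_def numerals4 A5 A6 meet_def
    by (simp_all only: not_sym if_True if_False refl simp_thms)
      (simp_all add: Int_commute insert_commute)

  have ex1: "\<forall>i. (\<exists>!l. proj_line l \<and> (\<forall>P\<in>fst (ell_points A g h i). P \<subseteq> l)) \<and>
              (\<exists>!l. proj_line l \<and> (\<forall>P\<in>snd (ell_points A g h i). P \<subseteq> l))"
    unfolding forall_4 ell_points fst_conv snd_conv by (intro conjI M(1) N(1))

  define T where "T = t 1 * t 2 * t 3 * t 4"
  \<comment> \<open>Shifting \<open>i\<close> by 2 swaps \<open>s (i+3)\<close> and
    \<open>s (i+1)\<close>. The two minus signs for \<open>N\<close> cancel in the product.\<close>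
  have MM: "line_through (M i) = line_through (M (i+2)) \<longleftrightarrow> t i * t (i+1) * (t (i+2) * t (i+3)) = 1"
   and NN: "line_through (N i) = line_through (N (i+2)) \<longleftrightarrow> t i * t (i+1) * (t (i+2) * t (i+3)) = 1" for i
    unfolding M N index4 line_of_pencil_eq_iff[OF ss] by simp_all
  have ell: "ell1 A g h i = ell2 A g h i \<longleftrightarrow> T = 1" for i
  proof -
    have "\<forall>i. ell1 A g h i = ell2 A g h i \<longleftrightarrow> T = 1"
      unfolding forall_4 ell1_def ell2_def ell_points fst_conv snd_conv
      using MM[of 1] MM[of 2] NN[of 1] NN[of 2] unfolding numerals4 T_def
      by (auto simp: ac_simps)
    then show ?thesis ..
  qed

  \<comment> \<open>At each neighbour of vertex \<open>i\<close> one of the two side forms in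
    \<open>w i\<close> vanishes; the other gives the same vertex determinant, up to the factor
    \<open>t i\<close>.\<close>
  have w_next: "w i \<bullet> p (i+1) = d (i+3)" and w_prev: "w i \<bullet> p (i+3) = t i * d (i+3)" for i
    unfolding w_def s_def d_def index4 by (simp_all add: cross3_simps)

  \<comment> \<open>Condition (ii)\<close>
  have "seg_ratio (A (i+3)) (vline A (i+3) (i+1) \<inter> g i) (A (i+1)) = - t i" for i
  proof -
    have "A (i+3) \<noteq> A (i+1)"
      using A2[of "i+1"] by (simp add: index4)
    then show ?thesis
      using seg_ratio_line_of[of "A (i+3)" "A (i+1)" "w i"] w_next[of i] w_prev[of i] d
      by (simp add: vline g p_def w_def)
  qed
  \<comment> \<open>The four minus signs cancel; \<open>vline_sym\<close> matches the two directions
    in which each diagonal is written.\<close>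
  from this[of 1] this[of 2] this[of 3] this[of 4]
  have "cond_ii A g \<longleftrightarrow> T = 1"
    unfolding cond_ii_def D_pt_def meet_def T_def numerals4
    by (simp add: vline_sym Int_commute ac_simps)

  \<comment> \<open>Condition (i)\<close>
  moreover have "cond_i A g \<longleftrightarrow> T = 1" if "cond_i_defined A g"
  proof -
    \<comment> \<open>The value of \<open>w i\<close> at the opposite vertex; it vanishes exactly
      when \<open>g i\<close> is a diagonal.\<close>
    define c where "c i = w i \<bullet> p (i+2)" for i
    have B: "B_pt A g i (i+1) k = line_of (cross3 (p i) (p (i+1))) \<inter> line_of (w k)" for i k
      by (simp add: B_pt_def meet_def side s_def g w_def)
    have c: "c k \<noteq> 0" for k
    proof
      assume c0: "c k = 0"
      \<comment> \<open>A diagonal \<open>g k\<close> would meet the side from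
        \<open>A (k+2)\<close> to \<open>A (k+3)\<close> in the vertex \<open>A (k+2)\<close>,
        against \<open>cond_i_defined\<close>.\<close>
      have "B_pt A g (k+2) (k+3) k = pt (A (k+2))"
        using B[of "k+2" k] line_of_cross3_homog_Int[OF A1, of "w k" "k+2"] c0 w_prev[of k] d t
        by (simp add: index4 p_def c_def pt_homog span_singleton_scale[of "- _", simplified])
      then show False
        using that unfolding cond_i_defined_def by (metis index4)
    qed
    have B2: "seg_ratio (A i) (B_pt A g i (i+1) (i+2)) (A (i+1)) = - c (i+2) / (t (i+2) * d (i+1))" for i
      using seg_ratio_line_of[OF A1, of "w (i+2)" i] w_prev[of "i+2"] d t
      by (simp add: B index4 c_def p_def)
    have B3: "seg_ratio (A i) (B_pt A g i (i+1) (i+3)) (A (i+1)) = - d (i+2) / c (i+3)" for i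
      using seg_ratio_line_of[OF A1, of "w (i+3)" i] w_next[of "i+3"] c[of "i+3"]
      by (simp add: B index4 c_def p_def)
    \<comment> \<open>Over the full cycle every \<open>c\<close> and every \<open>d\<close> occurs
      once above and once below, and the eight signs cancel.\<close>
    have "(\<Prod>i\<in>UNIV. seg_ratio (A i) (B_pt A g i (i+1) (i+2)) (A (i+1)) *
                seg_ratio (A i) (B_pt A g i (i+1) (i+3)) (A (i+1))) = 1 / T"
      unfolding B2 B3 prod_4 numerals4 T_def using c d by simp
    moreover have "T \<noteq> 0"
      using t by (simp add: T_def)
    ultimately show ?thesis
      unfolding cond_i_def by simp
  qed
  ultimately show ?thesis
    using ex1 ell by simp
qed

end
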